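(* Let $n\le m$, let $\mathcal{F}=[c_1,\ldots,c_n]$ be an $m\times n$-Ferrers diagram and $2\leq\delta\leq n$. Set $\ell=n-\delta+1$. Suppose $$c_\ell=c_{\ell+1}<m\quad\text{and}\quad\gcd(c_\ell,m)=1.$$ If $\nu_{\min}(\mathcal{F};\delta)=\nu_0(\mathcal{F};\delta)=\sum_{t=1}^\ell c_t$, then a maximal $[\mathcal{F};\delta]_q$-code does not exist as an $\mathbb{F}_q$-subspace of an $\mathbb{F}_{q^m}$-linear $[m\times n;\delta]$-MRD code; that is, for every $\mathbb{F}_{q^m}$-linear $[m\times n;\delta]$-MRD code $\mathcal{M}\subseteq\mathbb{F}_{q^m}^n$ and every ordered basis $B$ of $\mathbb{F}_{q^m}$ over $\mathbb{F}_q$, no $\mathbb{F}_q$-subspace of $\phi_B(\mathcal{M})\subseteq\mathbb{F}_q^{m\times n}$ is a maximal $[\mathcal{F};\delta]_q$-code.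
   Context: $q$ is a prime power, $[n]=\{1,\ldots,n\}$. An $m\times n$-Ferrers diagram is a set $\mathcal{F}\subseteq[m]\times[n]$ such that $(i,j)\in\mathcal{F}$, $j<n$ implies $(i,j+1)\in\mathcal{F}$, and $(i,j)\in\mathcal{F}$, $i>1$ implies $(i-1,j)\in\mathcal{F}$. It is identified with $[c_1,\ldots,c_n]$, where $c_j$ is the number of elements of $\mathcal{F}$ in column $j$ (so $0\le c_1\le\dots\le c_n\le m$). A rank-metric code is an $\mathbb{F}_q$-subspace of $\mathbb{F}_q^{m\times n}$ or of $\mathbb{F}_{q^m}^n$, where the rank of $(a_1,\ldots,a_n)\in\mathbb{F}_{q^m}^n$ is $\dim_{\mathbb{F}_q}\langle a_1,\ldots,a_n\rangle_{\mathbb{F}_q}$; its rank distance is the minimum rank of its nonzero elements. For $n\le m$, an $[m\times n;\delta]$-MRD code is a rank-metric code of $\mathbb{F}_q$-dimension $m(n-\delta+1)$ and rank distance $\delta$; it is $\mathbb{F}_{q^m}$-linear if it is an $\mathbb{F}_{q^m}$-subspace of $\mathbb{F}_{q^m}^n$. For an ordered basis $B$ of $\mathbb{F}_{q^m}$ over $\mathbb{F}_q$, $\phi_B:\mathbb{F}_{q^m}^n\to\mathbb{F}_q^{m\times n}$ maps $(a_1,\ldots,a_n)$ to the matrix whose $j$-th column is the coordinate vector of $a_j$ with respect to $B$. An $[\mathcal{F};\delta]_q$-code is a rank-metric code in $\mathbb{F}_q^{m\times n}$ with rank distance $\delta$ all of whose matrices have their nonzero entries only at positions in $\mathcal{F}$.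 For $j=0,\ldots,\delta-1$ put $\nu_j(\mathcal{F};\delta)=\sum_{t=1}^{n-\delta+1+j}\max\{c_t-j,0\}$ and $\nu_{\min}(\mathcal{F};\delta)=\min\{\nu_0,\ldots,\nu_{\delta-1}\}$. An $[\mathcal{F};\delta]_q$-code is maximal if its dimension is $\nu_{\min}(\mathcal{F};\delta)$. *)

theory Defs
  imports "Jordan_Normal_Form.DL_Rank"
begin

text \<open>
  The field $F_q$ is a type \<open>'a :: {field, finite}\<close>, the field $F_{q^m}$ is a type
  \<open>'b :: {field, finite}\<close> together with a field homomorphism \<open>\<iota> :: 'a \<Rightarrow> 'b\<close>.
  Matrices and vectors are indexed from 0, Ferrers diagrams from 1.
\<close>


section \<open>Vector spaces over the small field\<close>

text \<open>\<open>restrict_scalars \<iota> V\<close> is the space \<open>V\<close> over $F_{q^m}$ regarded as a space over $F_q$.\<close>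

definition restrict_scalars :: "('a \<Rightarrow> 'b) \<Rightarrow> ('b, 'v) module \<Rightarrow> ('a, 'v) module" where
  "restrict_scalars \<iota> V =
    \<lparr> carrier = carrier V, mult = mult V, one = one V, zero = zero V, add = add V,
      smult = (\<lambda>a. smult V (\<iota> a)) \<rparr>"

definition self_module :: "'b :: field itself \<Rightarrow> ('b, 'b) module" where
  "self_module ty =
    \<lparr> carrier = UNIV, mult = (*), one = 1, zero = 0, add = (+), smult = (*) \<rparr>"

abbreviation ext_space :: "('a :: field \<Rightarrow> 'b :: field) \<Rightarrow> ('a, 'b) module" where
  "ext_space \<iota> \<equiv> restrict_scalars \<iota> (self_module TYPE('b))"

abbreviation ext_vec_space :: "('a :: field \<Rightarrow> 'b :: field) \<Rightarrow> nat \<Rightarrow> ('a, 'b vec) module" where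
  "ext_vec_space \<iota> n \<equiv> restrict_scalars \<iota> (module_vec TYPE('b) n)"

definition subspace_dim :: "('a :: field, 'v) module \<Rightarrow> 'v set \<Rightarrow> nat" where
  "subspace_dim V W = vectorspace.dim class_ring (V\<lparr>carrier := W\<rparr>)"

definition ordered_basis :: "('a :: field \<Rightarrow> 'b :: field) \<Rightarrow> 'b list \<Rightarrow> bool" where
  "ordered_basis \<iota> B \<longleftrightarrow>
    distinct B \<and> vectorspace.basis class_ring (ext_space \<iota>) (set B)"

text \<open>The \<open>THE\<close> below is well defined only if \<open>B\<close> is an ordered basis.\<close>

definition coord_vec :: "('a :: field \<Rightarrow> 'b :: field) \<Rightarrow> 'b list \<Rightarrow> 'b \<Rightarrow> 'a vec" where
  "coord_vec \<iota> B x =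
    (THE a. a \<in> carrier_vec (length B) \<and> x = (\<Sum>i<length B. \<iota> (a $ i) * B ! i))"

definition phi :: "('a :: field \<Rightarrow> 'b :: field) \<Rightarrow> 'b list \<Rightarrow> 'b vec \<Rightarrow> 'a mat" where
  "phi \<iota> B v = mat (length B) (dim_vec v) (\<lambda>(i, j). coord_vec \<iota> B (v $ j) $ i)"


section \<open>Rank-metric codes\<close>

text \<open>
  \<open>rk\<close> is the rank function and \<open>z\<close> the zero element of the ambient space.
  For a code without nonzero elements the minimum does not exist; such a code has no
  rank distance.
\<close>

definition has_rank_distance :: "('v \<Rightarrow> nat) \<Rightarrow> 'v \<Rightarrow> 'v set \<Rightarrow> nat \<Rightarrow> bool" where
  "has_rank_distance rk z C \<delta> \<longleftrightarrow>
    (\<exists>x\<in>C - {z}. rk x = \<delta>) \<and> (\<forall>x\<in>C - {z}. \<delta> \<le> rk x)"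

definition vec_rank :: "('a :: field \<Rightarrow> 'b :: field) \<Rightarrow> 'b vec \<Rightarrow> nat" where
  "vec_rank \<iota> v =
    subspace_dim (ext_space \<iota>)
      (LinearCombinations.module.span class_ring (ext_space \<iota>) (set\<^sub>v v))"

definition MRD_code :: "('a :: field \<Rightarrow> 'b :: field) \<Rightarrow> nat \<Rightarrow> nat \<Rightarrow> nat \<Rightarrow> 'b vec set \<Rightarrow> bool"
  where
  "MRD_code \<iota> m n \<delta> M \<longleftrightarrow>
    VectorSpace.subspace class_ring M (ext_vec_space \<iota> n) \<and>
    subspace_dim (ext_vec_space \<iota> n) M = m * (n - \<delta> + 1) \<and>
    has_rank_distance (vec_rank \<iota>) (0\<^sub>v n) M \<delta>"

definition linear_MRD_code ::
    "('a :: field \<Rightarrow> 'b :: field) \<Rightarrow> nat \<Rightarrow> nat \<Rightarrow> nat \<Rightarrow> 'b vec set \<Rightarrow> bool" where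
  "linear_MRD_code \<iota> m n \<delta> M \<longleftrightarrow>
    MRD_code \<iota> m n \<delta> M \<and> VectorSpace.subspace class_ring M (module_vec TYPE('b) n)"


section \<open>Ferrers diagrams\<close>

definition ferrers_diagram :: "nat \<Rightarrow> nat \<Rightarrow> (nat \<times> nat) set \<Rightarrow> bool" where
  "ferrers_diagram m n F \<longleftrightarrow>
    F \<subseteq> {1..m} \<times> {1..n} \<and>
    (\<forall>i j. (i, j) \<in> F \<and> j < n \<longrightarrow> (i, j + 1) \<in> F) \<and>
    (\<forall>i j. (i, j) \<in> F \<and> i > 1 \<longrightarrow> (i - 1, j) \<in> F)"

definition col_count :: "(nat \<times> nat) set \<Rightarrow> nat \<Rightarrow> nat" where
  "col_count F j = card {i. (i, j) \<in> F}"

text \<open>Subtraction on \<open>nat\<close> truncates at 0, so \<open>col_count F t - j\<close> is $\max\{c_t - j, 0\}$.\<close>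

definition nu :: "nat \<Rightarrow> (nat \<times> nat) set \<Rightarrow> nat \<Rightarrow> nat \<Rightarrow> nat" where
  "nu n F \<delta> j = (\<Sum>t = 1..n - \<delta> + 1 + j. col_count F t - j)"

definition nu_min :: "nat \<Rightarrow> (nat \<times> nat) set \<Rightarrow> nat \<Rightarrow> nat" where
  "nu_min n F \<delta> = Min (nu n F \<delta> ` {..<\<delta>})"

definition ferrers_code ::
    "nat \<Rightarrow> nat \<Rightarrow> (nat \<times> nat) set \<Rightarrow> nat \<Rightarrow> 'a :: field mat set \<Rightarrow> bool" where
  "ferrers_code m n F \<delta> C \<longleftrightarrow>
    VectorSpace.subspace class_ring C (module_mat TYPE('a) m n) \<and>
    has_rank_distance (vec_space.rank m) (0\<^sub>m m n) C \<delta> \<and>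
    (\<forall>X\<in>C. \<forall>i<m. \<forall>j<n. X $$ (i, j) \<noteq> 0 \<longrightarrow> (i + 1, j + 1) \<in> F)"

definition maximal_ferrers_code ::
    "nat \<Rightarrow> nat \<Rightarrow> (nat \<times> nat) set \<Rightarrow> nat \<Rightarrow> 'a :: field mat set \<Rightarrow> bool" where
  "maximal_ferrers_code m n F \<delta> C \<longleftrightarrow>
    ferrers_code m n F \<delta> C \<and>
    subspace_dim (module_mat TYPE('a) m n) C = nu_min n F \<delta>"

end

theory Submission
  imports Defs
begin

text \<open>
  Let $V_c$ be the span over $F_q$ of the first $c$ basis vectors. A codeword of $M$ is determined
  by its first $l$ entries, since otherwise some nonzero codeword would have rank at most
  $n - l = \delta - 1$. In a code with support in $F$ these entries lie in
  $V_{c_1} \times \dots \times V_{c_l}$, and a code of dimension $\nu_0$ realizes every such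
  choice. Taking all but the $l$-th entry to be zero and scaling gives $g = (0, \dots, 0, 1, a, \dots)
  \in M$, and since $c_l = c_{l+1}$, multiplication by $a$ maps $V_{c_l}$ into itself.
  Multiplying together the nonzero elements of $V_{c_l}$, as in the proof of Fermat's little
  theorem, gives $a^{q^{c_l}} = a$; together with $a^{q^m} = a$ and $\gcd(c_l, m) = 1$ this yields
  $a^q = a$, so $a \in F_q$. Then the entries $1, a$ of $g$ are proportional over $F_q$, so
  the rank of $g$ is at most $\delta - 1$, a contradiction.
\<close>

section \<open>Cardinalities and dimensions of spaces over a finite field\<close>

lemma (in vectorspace) card_carrier_basis:
  assumes "finite A" and "basis A"
  shows "card (carrier V) = card (carrier K) ^ card A"
proof -
  have "A \<subseteq> carrier V"
    using assms(2) by (simp add: basis_def)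
  then have ex1: "\<exists>!a. a \<in> A \<rightarrow>\<^sub>E carrier K \<and> lincomb a A = v" if "v \<in> carrier V" for v
    using basis_criterion[OF assms(1)] assms(2) that by simp
  have "bij_betw (\<lambda>a. lincomb a A) (A \<rightarrow>\<^sub>E carrier K) (carrier V)"
    unfolding bij_betw_def
  proof
    have cl: "lincomb a A \<in> carrier V" if "a \<in> A \<rightarrow>\<^sub>E carrier K" for a
      using that \<open>A \<subseteq> carrier V\<close> by (intro lincomb_closed) auto
    show "inj_on (\<lambda>a. lincomb a A) (A \<rightarrow>\<^sub>E carrier K)"
      by (intro inj_onI) (metis ex1 cl)
    show "(\<lambda>a. lincomb a A) ` (A \<rightarrow>\<^sub>E carrier K) = carrier V"
    proof (intro equalityI subsetI)
      fix v assume "v \<in> carrier V"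
      then obtain a where "a \<in> A \<rightarrow>\<^sub>E carrier K" "lincomb a A = v"
        using ex1 by blast
      then show "v \<in> (\<lambda>a. lincomb a A) ` (A \<rightarrow>\<^sub>E carrier K)"
        by blast
    qed (use cl in blast)
  qed
  then have "card (carrier V) = card (A \<rightarrow>\<^sub>E carrier K)"
    by (simp add: bij_betw_same_card)
  then show ?thesis
    using assms(1) by (simp add: card_PiE)
qed

lemma (in vectorspace) card_carrier:
  assumes "fin_dim"
  shows "card (carrier V) = card (carrier K) ^ dim"
proof -
  obtain A where "finite A" "basis A"
    using finite_basis_exists[OF assms] by blast
  then show ?thesis
    using card_carrier_basis dim_basis by simp
qed

lemma (in vectorspace) card_span_le:
  assumes "finite (carrier K)" and "finite S" and "S \<subseteq> carrier V"
  shows "finite (span S)" and "card (span S) \<le> card (carrier K) ^ card S"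
proof -
  have sub: "span S \<subseteq> (\<lambda>a. lincomb a S) ` (S \<rightarrow>\<^sub>E carrier K)"
  proof
    fix v assume "v \<in> span S"
    then obtain a where a: "a \<in> S \<rightarrow> carrier K" "lincomb a S = v"
      using finite_in_span[OF assms(2,3)] by blast
    have "lincomb (restrict a S) S = v"
      unfolding a(2)[symmetric] using a(1) assms(3) by (intro lincomb_cong) auto
    moreover have "restrict a S \<in> S \<rightarrow>\<^sub>E carrier K"
      using a(1) by auto
    ultimately show "v \<in> (\<lambda>a. lincomb a S) ` (S \<rightarrow>\<^sub>E carrier K)"
      by blast
  qed
  have fin: "finite (S \<rightarrow>\<^sub>E carrier K)"
    using assms(1,2) by (intro finite_PiE)
  show "finite (span S)"
    using sub fin by (meson finite_imageI finite_subset)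
  have "card (span S) \<le> card (S \<rightarrow>\<^sub>E carrier K)"
    using fin sub by (rule surj_card_le)
  then show "card (span S) \<le> card (carrier K) ^ card S"
    using assms(2) by (simp add: card_PiE)
qed

text \<open>A finite \<open>W\<close> spans itself, so it is finite-dimensional and coordinates can
  be counted. This turns the dimensions in the definitions into cardinalities, which inclusions and
  injections compare directly.\<close>

lemma card_subspace:
  fixes V :: "('a :: {field, finite}, 'v) module"
  assumes "VectorSpace.subspace class_ring W V" and "finite W"
  shows "card W = card (UNIV :: 'a set) ^ subspace_dim V W"
proof -
  interpret W: vectorspace "class_ring :: 'a ring" "V\<lparr>carrier := W\<rparr>"
    using assms(1) by (intro vectorspace.subspace_is_vs) (auto simp: VectorSpace.subspace_def)
  have "W.fin_dim"
    unfolding W.fin_dim_def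
    using assms(2) W.in_own_span[of W] W.span_is_subset2[of W] by (intro exI[of _ W]) auto
  from W.card_carrier[OF this] show ?thesis
    by (simp add: subspace_dim_def)
qed

text \<open>The span of \<open>S\<close> lies in that of \<open>T\<close>, so the sizes compare, and
  with them the exponents of q.\<close>

lemma subspace_dim_span_le:
  fixes V :: "('a :: {field, finite}, 'v) module"
  assumes V: "vectorspace class_ring V"
    and "finite T" and "T \<subseteq> carrier V"
    and "S \<subseteq> LinearCombinations.module.span class_ring V T"
  shows "subspace_dim V (LinearCombinations.module.span class_ring V S) \<le> card T"
proof -
  interpret V: vectorspace "class_ring :: 'a ring" V
    by (fact V)
  let ?q = "card (UNIV :: 'a set)"
  have subT: "submodule class_ring (V.span T) V"
    using assms(3) by (rule V.span_is_submodule)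
  have "S \<subseteq> carrier V"
    using assms(3,4) V.span_is_subset2 by blast
  then have subS: "VectorSpace.subspace class_ring (V.span S) V"
    by (rule V.span_is_subspace)
  have le: "V.span S \<subseteq> V.span T"
    using assms(4) subT by (rule V.span_is_subset)
  have finT: "finite (V.span T)"
    using V.card_span_le(1)[OF _ assms(2,3)] by simp
  have "?q ^ subspace_dim V (V.span S) = card (V.span S)"
    using card_subspace[OF subS] finite_subset[OF le finT] by simp
  also have "\<dots> \<le> card (V.span T)"
    by (rule card_mono[OF finT le])
  also have "\<dots> \<le> ?q ^ card T"
    using V.card_span_le(2)[OF _ assms(2,3)] by simp
  finally show ?thesis
    \<comment> \<open>The set of 0 and 1 witnesses q > 1, which makes the powers of q strictly
      increasing in the exponent.\<close>
    using card_mono[of UNIV "{0, 1 :: 'a}"] by (simp add: power_increasing_iff)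
qed

section \<open>Elements fixed by powers of the Frobenius map\<close>

text \<open>A nonzero \<open>a\<close> permutes the nonzero elements of \<open>V\<close> by
  multiplication; comparing their products before and after gives exponent \<open>card V - 1\<close>
  for 1. Used for an initial space and for both whole fields.\<close>

lemma pow_card_eq_self:
  fixes a :: "'b :: field"
  assumes "finite V" and "0 \<in> V" and "\<And>x. x \<in> V \<Longrightarrow> a * x \<in> V"
  shows "a ^ card V = a"
proof (cases "a = 0")
  case True
  then show ?thesis
    \<comment> \<open>The exponent is positive because \<open>V\<close> contains 0.\<close>
    using assms(1,2) by (auto simp: power_0_left)
next
  case False
  let ?W = "V - {0}"
  have inj: "inj_on ((*) a) ?W"
    using False by (auto simp: inj_on_def)
  have "(*) a ` ?W \<subseteq> ?W"
    using assms(3) False by auto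
  then have "(*) a ` ?W = ?W"
    using assms(1) inj by (intro endo_inj_surj) auto
  then have "\<Prod>?W = (\<Prod>x\<in>?W. a * x)"
    using prod.reindex[OF inj, of "\<lambda>x. x"] by simp
  also have "\<dots> = a ^ card ?W * \<Prod>?W"
    by (simp add: prod.distrib)
  finally have "a ^ card ?W = 1"
    using assms(1) by simp
  moreover have "card V = Suc (card ?W)"
    using card.remove[OF assms(1,2)] .
  ultimately show ?thesis
    by simp
qed

lemma pow_pow_mult_eq_self:
  fixes a :: "'b :: monoid_mult"
  assumes "a ^ (q ^ k) = a"
  shows "a ^ (q ^ (k * i)) = a"
proof (induction i)
  case (Suc i)
  have "a ^ (q ^ (k * Suc i)) = (a ^ (q ^ k)) ^ (q ^ (k * i))"
    by (simp add: power_add power_mult)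
  then show ?case
    using assms Suc by simp
qed simp

text \<open>Bezout gives \<open>c * x = m * y + 1\<close>. Raising to the power q that many times
  fixes \<open>a\<close>, and so does doing it \<open>m * y\<close> times, so the one remaining time
  fixes \<open>a\<close> too.\<close>

lemma pow_eq_self_coprime:
  fixes a :: "'b :: monoid_mult"
  assumes "a ^ (q ^ c) = a" and "a ^ (q ^ m) = a" and "coprime c m" and "c \<noteq> 0"
  shows "a ^ q = a"
proof -
  obtain x y where xy: "c * x = m * y + 1"
    using bezout_nat[OF assms(4), of m] assms(3) by auto
  have "a = a ^ (q ^ (m * y + 1))"
    using pow_pow_mult_eq_self[OF assms(1)] xy by metis
  also have "\<dots> = (a ^ (q ^ (m * y))) ^ q"
    by (simp only: power_add power_mult power_one_right)
  finally show ?thesis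
    using pow_pow_mult_eq_self[OF assms(2), of y] by simp
qed

text \<open>The q elements of the embedded small field are already roots of X^q - X, whose degree
  leaves no room for another root.\<close>

lemma pow_card_eq_self_imp_range:
  fixes \<iota> :: "'a :: {field, finite} \<Rightarrow> 'b :: field"
  assumes "field_hom \<iota>" and "a ^ card (UNIV :: 'a set) = a"
  shows "a \<in> range \<iota>"
proof (rule ccontr)
  interpret field_hom \<iota> by fact
  let ?q = "card (UNIV :: 'a set)"
  assume a: "a \<notin> range \<iota>"
  have q: "1 < ?q"
    using card_mono[of UNIV "{0, 1 :: 'a}"] by simp
  define p where "p = (monom 1 ?q - monom 1 1 :: 'b poly)"
  have "coeff p ?q = 1"
    using q by (simp add: p_def)
  then have p: "p \<noteq> 0"
    by auto
  have "degree p \<le> ?q"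
    unfolding p_def using q by (intro degree_diff_le degree_monom_le[THEN order_trans]) auto
  have "insert a (range \<iota>) \<subseteq> {x. poly p x = 0}"
  proof -
    have "\<iota> x ^ ?q = \<iota> x" for x
      using pow_card_eq_self[of "UNIV :: 'a set" x] by (metis UNIV_I finite hom_power)
    then show ?thesis
      using assms(2) by (auto simp: p_def poly_monom)
  qed
  then have "card (insert a (range \<iota>)) \<le> card {x. poly p x = 0}"
    by (intro card_mono poly_roots_finite p)
  also have "\<dots> \<le> degree p"
    by (rule card_poly_roots_bound[OF p])
  finally show False
    using a \<open>degree p \<le> ?q\<close> card_image[OF inj_f] by simp
qed

section \<open>The extension field as a space over the small field, and a bound on rank\<close>

lemma vectorspace_ext_space:
  assumes "field_hom (\<iota> :: 'a :: field \<Rightarrow> 'b :: field)"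
  shows "vectorspace class_ring (ext_space \<iota>)"
proof -
  interpret field_hom \<iota> by fact
  show ?thesis
    by (rule vs_criteria[OF class_field])
      (auto simp: restrict_scalars_def self_module_def algebra_simps hom_distribs
        intro: exI[of _ "- x" for x])
qed

lemma lincomb_ext_space:
  assumes "field_hom (\<iota> :: 'a :: field \<Rightarrow> 'b :: field)" and "finite S"
  shows "LinearCombinations.module.lincomb (ext_space \<iota>) f S = (\<Sum>b\<in>S. \<iota> (f b) * b)"
proof -
  interpret V: vectorspace "class_ring :: 'a ring" "ext_space \<iota>"
    using assms(1) by (rule vectorspace_ext_space)
  have "(\<Oplus>\<^bsub>ext_space \<iota>\<^esub>b\<in>S. g b) = sum g S" for g
    using assms(2)
  proof (induction S)
    case empty
    then show ?case
      unfolding V.finsum_empty by (simp add: restrict_scalars_def self_module_def)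
  next
    case (insert b S)
    then show ?case
      by (subst V.finsum_insert) (auto simp: restrict_scalars_def self_module_def)
  qed
  then show ?thesis
    unfolding V.lincomb_def by (simp add: restrict_scalars_def self_module_def)
qed

text \<open>The entries at the positions in \<open>J\<close> span all entries. Both contradictions
  with the minimum distance arise by exhibiting a \<open>J\<close> of size \<delta> - 1.\<close>

lemma vec_rank_le:
  fixes \<iota> :: "'a :: {field, finite} \<Rightarrow> 'b :: field"
  assumes "field_hom \<iota>" and "finite J"
    and in_span: "\<And>j. j < dim_vec v \<Longrightarrow> \<exists>k\<in>J. \<exists>b. v $ j = \<iota> b * v $ k"
  shows "vec_rank \<iota> v \<le> card J"
proof -
  interpret V: vectorspace "class_ring :: 'a ring" "ext_space \<iota>"
    using assms(1) by (rule vectorspace_ext_space)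
  have carrier: "carrier (ext_space \<iota>) = UNIV"
    by (simp add: restrict_scalars_def self_module_def)
  let ?T = "($) v ` J"
  have "set\<^sub>v v \<subseteq> V.span ?T"
  proof
    fix x assume "x \<in> set\<^sub>v v"
    then obtain k b where "k \<in> J" and x: "x = \<iota> b * v $ k"
      using in_span by (metis vec_setE)
    then have "v $ k \<in> V.span ?T"
      using V.in_own_span[of ?T] carrier by blast
    then have "b \<odot>\<^bsub>ext_space \<iota>\<^esub> (v $ k) \<in> V.span ?T"
      using V.span_is_submodule[of ?T] carrier
      by (intro submodule.smult_closed[where R = class_ring]) auto
    then show "x \<in> V.span ?T"
      by (simp add: x restrict_scalars_def self_module_def)
  qed
  then have "vec_rank \<iota> v \<le> card ?T"
    unfolding vec_rank_def using assms(2) carrier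
    by (intro subspace_dim_span_le V.vectorspace_axioms) auto
  also have "\<dots> \<le> card J"
    using assms(2) by (rule card_image_le)
  finally show ?thesis .
qed

section \<open>Coordinates with respect to an ordered basis\<close>

locale finite_extension = field_hom \<iota>
  for \<iota> :: "'a :: {field, finite} \<Rightarrow> 'b :: {field, finite}" +
  fixes B :: "'b list"
  assumes basis: "ordered_basis \<iota> B"
begin

abbreviation coord :: "'b \<Rightarrow> 'a vec" where
  "coord \<equiv> coord_vec \<iota> B"

text \<open>Justifies the \<open>THE\<close> in \<open>coord_vec\<close>. The basis criterion speaks
  of functions on the set of basis vectors; distinctness of \<open>B\<close> carries it over to
  positions in the list.\<close>

lemma coord_ex1:
  "\<exists>!a. a \<in> carrier_vec (length B) \<and> x = (\<Sum>i<length B. \<iota> (a $ i) * B ! i)"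
proof -
  have hom: "field_hom \<iota>" ..
  interpret V: vectorspace "class_ring :: 'a ring" "ext_space \<iota>"
    using hom by (rule vectorspace_ext_space)
  have carrier: "carrier (ext_space \<iota>) = UNIV"
    by (simp add: restrict_scalars_def self_module_def)
  have dist: "distinct B"
    using basis by (simp add: ordered_basis_def)
  then have bij: "bij_betw ((!) B) {..<length B} (set B)"
    by (intro bij_betw_nth) auto
  have comb: "V.lincomb f (set B) = (\<Sum>i<length B. \<iota> (f (B ! i)) * B ! i)" for f
    unfolding lincomb_ext_space[OF hom finite_set]
    by (rule sum.reindex_bij_betw[OF bij, symmetric])
  have "\<exists>!f. f \<in> set B \<rightarrow>\<^sub>E UNIV \<and> V.lincomb f (set B) = x"
    using V.basis_criterion[of "set B"] basis carrier by (simp add: ordered_basis_def)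
  then obtain f where f: "V.lincomb f (set B) = x"
    and uniq: "\<And>g. g \<in> set B \<rightarrow>\<^sub>E UNIV \<Longrightarrow> V.lincomb g (set B) = x \<Longrightarrow> g = f"
    by auto
  show ?thesis
  proof (intro ex1I conjI)
    show "vec (length B) (\<lambda>i. f (B ! i)) \<in> carrier_vec (length B)"
      by simp
    show "x = (\<Sum>i<length B. \<iota> (vec (length B) (\<lambda>i. f (B ! i)) $ i) * B ! i)"
      unfolding f[symmetric] comb by simp
  next
    fix a assume a: "a \<in> carrier_vec (length B) \<and> x = (\<Sum>i<length B. \<iota> (a $ i) * B ! i)"
    \<comment> \<open>The competing coordinates \<open>a\<close>, moved from positions to basis
      vectors and made extensional so that \<open>uniq\<close> applies.\<close>
    define g where "g = (\<lambda>b\<in>set B. a $ inv_into {..<length B} ((!) B) b)"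
    have g: "g (B ! i) = a $ i" if "i < length B" for i
      using that bij by (simp add: g_def bij_betw_inv_into_left)
    then have "V.lincomb g (set B) = x"
      using a by (simp add: comb)
    then have "g = f"
      by (intro uniq) (simp_all add: g_def)
    then show "a = vec (length B) (\<lambda>i. f (B ! i))"
      using a g by (intro eq_vecI) auto
  qed
qed

lemma coord_carrier: "coord x \<in> carrier_vec (length B)"
  and coord_expansion: "(\<Sum>i<length B. \<iota> (coord x $ i) * B ! i) = x"
  using theI'[OF coord_ex1[of x]] unfolding coord_vec_def by simp_all

lemma coord_eqI:
  "a \<in> carrier_vec (length B) \<Longrightarrow> x = (\<Sum>i<length B. \<iota> (a $ i) * B ! i) \<Longrightarrow> coord x = a"
  unfolding coord_vec_def by (rule the1_equality[OF coord_ex1]) simp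

lemma coord_inject: "coord x = coord y \<longleftrightarrow> x = y"
  using coord_expansion by metis

text \<open>This is the span $V_c$ of the first \<open>c\<close> basis vectors, given by vanishing
  coordinates so that membership can be read off the zero entries of a column of
  \<open>phi\<close>.\<close>

definition initial_space :: "nat \<Rightarrow> 'b set" where
  "initial_space c = {x. \<forall>i. c \<le> i \<and> i < length B \<longrightarrow> coord x $ i = 0}"

lemma zero_in_initial_space: "0 \<in> initial_space c"
proof -
  have "coord 0 = 0\<^sub>v (length B)"
    by (rule coord_eqI) simp_all
  then show ?thesis
    by (simp add: initial_space_def)
qed

text \<open>The first \<open>c\<close> coordinates can be chosen freely and determine the
  element.\<close>

lemma card_initial_space:
  assumes "c \<le> length B"
  shows "card (initial_space c) = card (UNIV :: 'a set) ^ c"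
proof -
  let ?h = "\<lambda>x. \<lambda>i\<in>{..<c}. coord x $ i"
  have "inj_on ?h (initial_space c)"
  proof (rule inj_onI)
    fix x y assume x: "x \<in> initial_space c" and y: "y \<in> initial_space c" and eq: "?h x = ?h y"
    have "coord x $ i = coord y $ i" if "i < length B" for i
    proof (cases "i < c")
      case True
      then show ?thesis
        using fun_cong[OF eq, of i] by simp
    next
      case False
      then show ?thesis
        using x y that by (simp add: initial_space_def)
    qed
    then have "coord x = coord y"
      using coord_carrier[of x] coord_carrier[of y] by (intro eq_vecI) auto
    then show "x = y"
      by (simp add: coord_inject)
  qed
  moreover have "?h ` initial_space c = {..<c} \<rightarrow>\<^sub>E UNIV"
  proof (intro equalityI subsetI)
    fix a :: "nat \<Rightarrow> 'a" assume a: "a \<in> {..<c} \<rightarrow>\<^sub>E UNIV"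
    let ?v = "vec (length B) (\<lambda>i. if i < c then a i else 0)"
    define x where "x = (\<Sum>i<length B. \<iota> (?v $ i) * B ! i)"
    have "coord x = ?v"
      by (rule coord_eqI) (simp_all add: x_def)
    then have "x \<in> initial_space c"
      by (simp add: initial_space_def)
    moreover have "?h x = a"
    proof
      fix i
      show "?h x i = a i"
        using assms PiE_arb[OF a, of i] by (simp add: \<open>coord x = ?v\<close>)
    qed
    ultimately show "a \<in> ?h ` initial_space c"
      by blast
  qed (auto split: if_splits)
  ultimately have "card (initial_space c) = card ({..<c} \<rightarrow>\<^sub>E (UNIV :: 'a set))"
    using card_image by metis
  then show ?thesis
    by (simp add: card_PiE)
qed

lemma card_extension: "card (UNIV :: 'b set) = card (UNIV :: 'a set) ^ length B"
proof -
  have "initial_space (length B) = UNIV"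
    by (auto simp: initial_space_def)
  then show ?thesis
    using card_initial_space[of "length B"] by simp
qed

end

section \<open>Columns of Ferrers diagrams\<close>

text \<open>Columns have no gaps towards row 1, so a cell in row \<open>i\<close> forces
  \<open>i\<close> cells. Hence a matrix supported in \<open>F\<close> vanishes in column
  \<open>j\<close> below row $c_j$.\<close>

lemma ferrers_diagram_row_le:
  assumes "ferrers_diagram m n F" and "(i, j) \<in> F"
  shows "i \<le> col_count F j"
proof -
  have up: "(i - 1, j) \<in> F" if "(i, j) \<in> F" "i > 1" for i
    using assms(1) that by (auto simp: ferrers_diagram_def)
  have "(k, j) \<in> F" if "k \<le> i" "1 \<le> k" for k
    using that
  proof (induction k rule: inc_induct)
    case (step k)
    then show ?case
      using up[of "Suc k"] by simp
  qed (use assms(2) in simp)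
  then have "{1..i} \<subseteq> {i. (i, j) \<in> F}"
    by auto
  moreover have "{i. (i, j) \<in> F} \<subseteq> {1..m}"
    using assms(1) by (auto simp: ferrers_diagram_def)
  then have "finite {i. (i, j) \<in> F}"
    by (rule finite_subset) simp
  ultimately have "card {1..i} \<le> card {i. (i, j) \<in> F}"
    by (intro card_mono)
  then show ?thesis
    by (simp add: col_count_def)
qed

lemma col_count_le:
  assumes "ferrers_diagram m n F"
  shows "col_count F j \<le> m"
proof -
  have "{i. (i, j) \<in> F} \<subseteq> {1..m}"
    using assms by (auto simp: ferrers_diagram_def)
  then show ?thesis
    unfolding col_count_def using card_mono[of "{1..m}"] by fastforce
qed

section \<open>Maximal Ferrers diagram codes inside linear MRD codes\<close>

theorem corollary4p2:
  fixes \<iota> :: "'a :: {field, finite} \<Rightarrow> 'b :: {field, finite}"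
    and m n \<delta> l :: nat and F :: "(nat \<times> nat) set"
  assumes "field_hom \<iota>" and "card (UNIV :: 'b set) = card (UNIV :: 'a set) ^ m"
    and "n \<le> m" and "ferrers_diagram m n F" and "2 \<le> \<delta>" and "\<delta> \<le> n"
    and "l = n - \<delta> + 1"
    and "col_count F l = col_count F (l + 1)" and "col_count F (l + 1) < m"
    and "gcd (col_count F l) m = 1"
    and "nu_min n F \<delta> = nu n F \<delta> 0"
  shows "\<forall>M B. linear_MRD_code \<iota> m n \<delta> M \<and> ordered_basis \<iota> B \<longrightarrow>
    \<not> (\<exists>C. C \<subseteq> phi \<iota> B ` M \<and> maximal_ferrers_code m n F \<delta> C)"
proof (intro allI impI notI)
  fix M B
  assume MB: "linear_MRD_code \<iota> m n \<delta> M \<and> ordered_basis \<iota> B"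
    and "\<exists>C. C \<subseteq> phi \<iota> B ` M \<and> maximal_ferrers_code m n F \<delta> C"
  then obtain C where CM: "C \<subseteq> phi \<iota> B ` M" and maxC: "maximal_ferrers_code m n F \<delta> C"
    by blast
  interpret finite_extension \<iota> B
    using assms(1) MB by (simp add: finite_extension_def finite_extension_axioms_def)
  let ?q = "card (UNIV :: 'a set)"
  have q: "1 < ?q"
    using card_mono[of UNIV "{0, 1 :: 'a}"] by simp
  \<comment> \<open>Both exponents describe the size of the large field as a power of q > 1.\<close>
  have len: "length B = m"
    using card_extension assms(2) q by simp
  define c where "c = col_count F"
  \<comment> \<open>Vectors are indexed from 0 and columns from 1: index \<open>k\<close> belongs to
    column \<open>l\<close>, and index \<open>l\<close> to column \<open>l + 1\<close>.\<close>
  define k where "k = l - 1"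
  have l: "l < n" "l = Suc k" "n - l = \<delta> - 1"
    using assms(5-7) by (auto simp: k_def)
  have c_le: "c j \<le> m" for j
    using col_count_le[OF assms(4)] by (simp add: c_def)
  have dist: "\<delta> \<le> vec_rank \<iota> v" if "v \<in> M" "v \<noteq> 0\<^sub>v n" for v
    using MB that by (auto simp: linear_MRD_code_def MRD_code_def has_rank_distance_def)
  have subM: "submodule class_ring M (module_vec TYPE('b) n)"
    using MB by (simp add: linear_MRD_code_def VectorSpace.subspace_def)
  have M_carrier: "v \<in> carrier_vec n" if "v \<in> M" for v
    using submodule.subset[OF subM] that by (auto simp: module_vec_simps)
  have M_smult: "x \<cdot>\<^sub>v v \<in> M" if "v \<in> M" for x v
    using submodule.smult_closed[OF subM, of x v] that by (simp add: module_vec_simps)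
  have M_diff: "v - w \<in> M" if "v \<in> M" "w \<in> M" for v w
  proof -
    have "v + (- 1) \<cdot>\<^sub>v w \<in> M"
      using submodule.m_closed[OF subM that(1) M_smult[OF that(2)]] by (simp add: module_vec_simps)
    moreover have "v + (- 1) \<cdot>\<^sub>v w = v - w"
      using M_carrier[OF that(1)] M_carrier[OF that(2)] by (intro eq_vecI) auto
    ultimately show ?thesis
      by simp
  qed
  have zero: "v = 0\<^sub>v n" if "v \<in> M" "\<And>t. t < l \<Longrightarrow> v $ t = 0" for v
  proof (rule ccontr)
    \<comment> \<open>A zero entry is 0 times the entry at index \<open>l\<close>, so the last
      \<delta> - 1 entries span all of them.\<close>
    have "\<exists>i\<in>{l..<n}. \<exists>b. v $ j = \<iota> b * v $ i" if "j < n" for j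
    proof (cases "j < l")
      case True
      then show ?thesis
        using \<open>l < n\<close> \<open>\<And>t. t < l \<Longrightarrow> v $ t = 0\<close>
        by (intro bexI[of _ l] exI[of _ 0]) auto
    next
      case False
      then show ?thesis
        using that by (intro bexI[of _ j] exI[of _ 1]) auto
    qed
    then have "vec_rank \<iota> v \<le> card {l..<n}"
      using M_carrier[OF that(1)] by (intro vec_rank_le[OF assms(1)]) auto
    moreover assume "v \<noteq> 0\<^sub>v n"
    ultimately show False
      using dist[OF that(1)] l assms(5) by simp
  qed
  have determined: "v = w" if "v \<in> M" "w \<in> M" "\<And>t. t < l \<Longrightarrow> v $ t = w $ t" for v w
  proof -
    have vw: "v \<in> carrier_vec n" "w \<in> carrier_vec n"
      using that M_carrier by auto
    have "v - w = 0\<^sub>v n"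
      using vw that l by (intro zero M_diff) auto
    then have "v $ i - w $ i = 0" if "i < n" for i
      using vw that by (metis carrier_vecD index_minus_vec(1) index_zero_vec(1))
    then show ?thesis
      using vw by (intro eq_vecI) auto
  qed

  \<comment> \<open>The code \<open>C\<close> pulled back to vectors over the large field, where
    multiplication by field elements is available.\<close>
  define M' where "M' = {v \<in> M. phi \<iota> B v \<in> C}"
  have M'_entry: "v $ j \<in> initial_space (c (j + 1))" if "v \<in> M'" "j < n" for v j
    unfolding initial_space_def
  proof (intro CollectI allI impI)
    fix i assume i: "c (j + 1) \<le> i \<and> i < length B"
    have v: "phi \<iota> B v \<in> C" "dim_vec v = n"
      using that(1) M_carrier by (auto simp: M'_def)
    have "(i + 1, j + 1) \<in> F" if "phi \<iota> B v $$ (i, j) \<noteq> 0"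
      using maxC v(1) that i \<open>j < n\<close> len
      unfolding maximal_ferrers_code_def ferrers_code_def by blast
    then have "phi \<iota> B v $$ (i, j) = 0"
      using ferrers_diagram_row_le[OF assms(4)] i by (fastforce simp: c_def)
    then show "coord (v $ j) $ i = 0"
      using i that(2) v(2) by (simp add: phi_def)
  qed
  \<comment> \<open>Reading off the first \<open>l\<close> entries maps \<open>M'\<close>
    injectively into the product \<open>P\<close> of the spaces prescribed by the diagram; a count
    then shows that it is onto.\<close>
  define r :: "'b vec \<Rightarrow> nat \<Rightarrow> 'b" where "r = (\<lambda>v. \<lambda>t\<in>{..<l}. v $ t)"
  define P where "P = PiE {..<l} (\<lambda>t. initial_space (c (t + 1)))"
  have finP: "finite P"
    unfolding P_def by (intro finite_PiE) auto
  have r_eq: "v $ t = w $ t" if "r v = r w" "t < l" for v w t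
    using fun_cong[OF that(1), of t] that(2) by (simp add: r_def)
  have inj: "inj_on r M'"
    by (rule inj_onI) (auto simp: M'_def intro: determined r_eq)
  have rP: "r ` M' \<subseteq> P"
    unfolding r_def P_def using M'_entry l(1) by (auto split: if_splits)
  have finM': "finite M'"
    using inj rP finP by (rule inj_on_finite)
  have "card P = (\<Prod>t<l. ?q ^ c (t + 1))"
    unfolding P_def using c_le len by (simp add: card_PiE card_initial_space)
  also have "\<dots> = ?q ^ (\<Sum>t<l. c (t + 1))"
    by (simp add: power_sum)
  also have "(\<Sum>t<l. c (t + 1)) = (\<Sum>t=1..l. c t)"
    by (rule sum.reindex_bij_witness[of _ "\<lambda>t. t - 1" "\<lambda>t. t + 1"]) auto
  \<comment> \<open>Here the hypothesis that the minimum is attained at \<nu>_0 enters: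
    \<open>P\<close> is exactly as large as a maximal code.\<close>
  also have "\<dots> = nu_min n F \<delta>"
    unfolding assms(11) nu_def c_def using assms(7) by simp
  finally have cardP: "card P = ?q ^ nu_min n F \<delta>" .
  have C: "C = phi \<iota> B ` M'"
    using CM by (auto simp: M'_def)
  have "card C = ?q ^ nu_min n F \<delta>"
    using maxC C finM' card_subspace[of C "module_mat TYPE('a) m n"]
    by (simp add: maximal_ferrers_code_def ferrers_code_def)
  \<comment> \<open>\<open>C\<close> is the image of \<open>M'\<close> under \<open>phi\<close>, so
    \<open>M'\<close> is at least as large as \<open>C\<close>.\<close>
  then have "card P \<le> card M'"
    using cardP C card_image_le[OF finM'] by metis
  then have surj: "r ` M' = P"
    using card_image[OF inj] by (intro card_seteq[OF finP rP]) simp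

  have lift: "\<exists>w\<in>M'. w $ k = y \<and> (\<forall>t<k. w $ t = 0)" if "y \<in> initial_space (c l)" for y
  proof -
    have "(\<lambda>t\<in>{..<l}. if t = k then y else 0) \<in> P"
      unfolding P_def using that zero_in_initial_space l(2) by auto
    then obtain w where w: "w \<in> M'" "r w = (\<lambda>t\<in>{..<l}. if t = k then y else 0)"
      using surj by (metis imageE)
    have "w $ t = (if t = k then y else 0)" if "t < l" for t
      using fun_cong[OF w(2), of t] that by (simp add: r_def)
    then show ?thesis
      using w(1) l(2) by (intro bexI[of _ w]) auto
  qed
  have c0: "c l \<noteq> 0"
  proof
    \<comment> \<open>Otherwise the gcd would be \<open>m\<close>, yet \<open>m\<close> is at least
      \<delta> and so at least 2.\<close>
    assume "c l = 0"
    then have "m = 1"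
      using assms(10) by (simp add: c_def)
    then show False
      using assms(3,5,6) by simp
  qed
  have cardV: "card (initial_space (c l)) = ?q ^ c l"
    using c_le len by (intro card_initial_space) simp
  have "\<not> initial_space (c l) \<subseteq> {0}"
    using card_mono[of "{0}" "initial_space (c l)"] cardV one_less_power[OF q, of "c l"] c0 by auto
  then obtain x where x: "x \<in> initial_space (c l)" "x \<noteq> 0"
    by auto
  then obtain v where v: "v \<in> M'" "v $ k = x" "\<And>t. t < k \<Longrightarrow> v $ t = 0"
    using lift by metis
  \<comment> \<open>Linearity of \<open>M\<close> over the large field keeps \<open>g\<close> in
    \<open>M\<close>; it need not lie in \<open>M'\<close>.\<close>
  define g where "g = inverse x \<cdot>\<^sub>v v"
  have "v \<in> M" "v \<in> carrier_vec n"
    using v(1) M_carrier by (auto simp: M'_def)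
  then have gM: "g \<in> M" and g_carrier: "g \<in> carrier_vec n"
    by (auto simp: g_def M_smult)
  have gk: "g $ k = 1" and g0: "\<And>t. t < k \<Longrightarrow> g $ t = 0"
    using v x l \<open>v \<in> carrier_vec n\<close> by (auto simp: g_def)
  define a where "a = g $ l"
  have closed: "a * y \<in> initial_space (c l)" if "y \<in> initial_space (c l)" for y
  proof -
    obtain w where w: "w \<in> M'" "w $ k = y" "\<And>t. t < k \<Longrightarrow> w $ t = 0"
      using lift \<open>y \<in> initial_space (c l)\<close> by metis
    \<comment> \<open>The lift \<open>w\<close> of \<open>y\<close> and the multiple of
      \<open>g\<close> by \<open>y\<close> agree in the first \<open>l\<close> entries, hence
      everywhere. So \<open>a * y\<close> is an entry of \<open>w\<close> in column
      \<open>l + 1\<close>, whose space is that of column \<open>l\<close>.\<close>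
    have "w $ t = (y \<cdot>\<^sub>v g) $ t" if "t < l" for t
      using that w g_carrier l gk g0 by (cases "t = k") auto
    then have "w = y \<cdot>\<^sub>v g"
      using w(1) gM by (intro determined M_smult) (auto simp: M'_def)
    then have "w $ l = a * y"
      using g_carrier l(1) by (simp add: a_def)
    then show ?thesis
      using M'_entry[OF w(1) l(1)] assms(8) by (simp add: c_def)
  qed
  have "a ^ (?q ^ c l) = a"
    using pow_card_eq_self[of "initial_space (c l)" a] closed zero_in_initial_space cardV by simp
  moreover have "a ^ (?q ^ m) = a"
    using pow_card_eq_self[of "UNIV :: 'b set" a] assms(2) by simp
  ultimately have "a ^ ?q = a"
    using assms(10) c0 by (intro pow_eq_self_coprime[of a ?q "c l" m]) (auto simp: c_def coprime_iff_gcd_eq_1)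
  then obtain b where b: "a = \<iota> b"
    using pow_card_eq_self_imp_range[OF assms(1)] by blast
  \<comment> \<open>Entries before \<open>k\<close> vanish, and entry \<open>l\<close> is a
    small-field multiple of entry \<open>k\<close>, which is 1. This leaves n - k - 1 = n - l =
    \<delta> - 1 positions.\<close>
  have "\<exists>i\<in>{k..<n} - {l}. \<exists>b. g $ j = \<iota> b * g $ i" if "j < n" for j
  proof -
    consider "j < k" | "j = l" | "j \<in> {k..<n} - {l}"
      using \<open>j < n\<close> by fastforce
    then show ?thesis
    proof cases
      case 1
      then show ?thesis
        using g0 l by (intro bexI[of _ k] exI[of _ 0]) auto
    next
      case 2
      then show ?thesis
        using gk l b by (intro bexI[of _ k] exI[of _ b]) (auto simp: a_def)
    next
      case 3
      then show ?thesis
        by (intro bexI[of _ j] exI[of _ 1]) auto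
    qed
  qed
  then have "vec_rank \<iota> g \<le> card ({k..<n} - {l})"
    using g_carrier by (intro vec_rank_le[OF assms(1)]) auto
  also have "\<dots> = \<delta> - 1"
    using l by (subst card_Diff_singleton) auto
  finally have "vec_rank \<iota> g < \<delta>"
    using assms(5) by simp
  moreover have "g \<noteq> 0\<^sub>v n"
    using gk l by auto
  ultimately show False
    using dist[OF gM] by simp
qed

end
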